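(* The set $[\mathbf{Z}]_q = \{[n]_q : n \in \mathbf{Z}\}$ is a commutative ring with the operations of quantum addition $\oplus_q$ and quantum multiplication $\otimes_q$ defined, for $m,n\in\mathbf{Z}$, by $$[m]_q \oplus_q [n]_q = [m]_q + q^m [n]_q, \qquad [m]_q \otimes_q [n]_q = [m]_q\,[n]_{q^m},$$ and the map $n \mapsto [n]_q$ from $\mathbf{Z}$ to $[\mathbf{Z}]_q$ is a ring isomorphism.
   Context: For $n\in\mathbf{Z}$, the quantum integer is $[n]_q=\frac{1-q^n}{1-q}$, regarded as a Laurent polynomial in the variable $q$: $[0]_q=0$, $[n]_q=1+q+\cdots+q^{n-1}$ for $n\ge 1$, and $[-n]_q=-\left(\frac1q+\frac1{q^2}+\cdots+\frac1{q^n}\right)$ for $n\ge 1$. The symbol $[n]_{q^m}$ denotes the result of substituting $q^m$ for $q$ in the Laurent polynomial $[n]_q$. On the right-hand sides of the definitions of $\oplus_q$ and $\otimes_q$, addition and multiplication are the ordinary ones for Laurent polynomials. *)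

theory Defs
  imports "HOL-Library.Poly_Mapping" "HOL-Algebra.IntRing"
begin

text \<open>The ring \<open>Z[q, 1/q]\<close> as the group ring of the additive group of integers: an element maps
  each exponent to its coefficient, and multiplication is convolution.\<close>

type_synonym laurent = "int \<Rightarrow>\<^sub>0 int"

definition qpow :: "int \<Rightarrow> laurent"
  where "qpow k = Poly_Mapping.single k 1"

text \<open>The substitution of \<open>q^m\<close> for \<open>q\<close>. Distinct exponents may collide: for \<open>m = 0\<close> the result is
  the constant given by the sum of the coefficients.\<close>

definition subst_qpow :: "int \<Rightarrow> laurent \<Rightarrow> laurent"
  where "subst_qpow m f =
    (\<Sum>k\<in>Poly_Mapping.keys f. Poly_Mapping.single (m * k) (Poly_Mapping.lookup f k))"

definition quantum_int :: "int \<Rightarrow> laurent"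
  where "quantum_int n =
    (if 0 \<le> n then (\<Sum>k\<in>{0..<n}. qpow k) else - (\<Sum>k\<in>{1..-n}. qpow (- k)))"

lemma qpow_add: "qpow (a + b) = qpow a * qpow b"
  by (simp add: qpow_def mult_single)

lemma qpow_0: "qpow 0 = 1"
  by (simp add: qpow_def)

text \<open>As \<open>laurent\<close> is an integral domain, this characterizes \<open>quantum_int n\<close> as the quotient
  \<open>(1 - q^n) / (1 - q)\<close>.\<close>

lemma quantum_int_quotient: "(1 - qpow 1) * quantum_int n = 1 - qpow n"
proof -
  have pos: "(1 - qpow 1) * (\<Sum>k\<in>{0..<int N}. qpow k) = 1 - qpow (int N)" for N
  proof (induction N)
    case 0
    show ?case by (simp add: qpow_0)
  next
    case (Suc N)
    have "{0..<int (Suc N)} = insert (int N) {0..<int N}" by auto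
    then show ?case
      using Suc by (simp add: distrib_left left_diff_distrib flip: qpow_add)
  qed
  have neg: "(1 - qpow 1) * - (\<Sum>k\<in>{1..int N}. qpow (- k)) = 1 - qpow (- int N)" for N
  proof (induction N)
    case 0
    show ?case by (simp add: qpow_0)
  next
    case (Suc N)
    have "{1..int (Suc N)} = insert (int (Suc N)) {1..int N}" by auto
    then have "(1 - qpow 1) * - (\<Sum>k\<in>{1..int (Suc N)}. qpow (- k)) =
        (1 - qpow 1) * - (\<Sum>k\<in>{1..int N}. qpow (- k)) - (1 - qpow 1) * qpow (- int (Suc N))"
      by (simp add: algebra_simps)
    also have "\<dots> = 1 - qpow (- int (Suc N))"
      by (subst Suc) (simp add: left_diff_distrib flip: qpow_add)
    finally show ?case .
  qed
  show ?thesis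
    using pos[of "nat n"] neg[of "nat (- n)"] by (cases "0 \<le> n") (simp_all add: quantum_int_def)
qed

text \<open>The operations on quantum integers are prescribed in terms of the index \<open>m\<close> of the left
  operand \<open>[m]_q\<close>, which is recovered from the Laurent polynomial by a definite description.
  Outside the set of quantum integers the values are irrelevant.\<close>

definition quantum_index :: "laurent \<Rightarrow> int"
  where "quantum_index f = (THE m. f = quantum_int m)"

definition qadd :: "laurent \<Rightarrow> laurent \<Rightarrow> laurent"
  where "qadd f g = f + qpow (quantum_index f) * g"

definition qmult :: "laurent \<Rightarrow> laurent \<Rightarrow> laurent"
  where "qmult f g = f * subst_qpow (quantum_index f) g"

definition quantum_ring :: "laurent ring"
  where "quantum_ring =
    \<lparr>carrier = range quantum_int, mult = qmult, one = quantum_int 1,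
     zero = quantum_int 0, add = qadd\<rparr>"

end

theory Submission
  imports Defs
begin

text \<open>A quantum integer is a geometric sum, so \<open>(1 - q) * [n] = 1 - q^n\<close>; the Laurent polynomials
  form an integral domain, and hence this identity determines \<open>[n]\<close>. It follows that
  \<open>[m + n] = [m] + q^m * [n]\<close>, because \<open>1 - q^(m + n) = (1 - q^m) + q^m * (1 - q^n)\<close>, and that
  \<open>[m] = [n]\<close> forces \<open>q^m = q^n\<close> and so \<open>m = n\<close>. Injectivity makes the index of a quantum
  integer well defined, so that the two operations are given by the prescribed formulas.

  The identity for products, \<open>[m * n] = [m] * [n]\<close> with \<open>q^m\<close> substituted for \<open>q\<close> in the second
  factor, says, for positive indices, that a progression of \<open>m * n\<close> exponents splits into \<open>n\<close> blocks of
  length \<open>m\<close>. It is proved by induction on \<open>n\<close> in both directions: one step adds \<open>q^n\<close> to \<open>[n]\<close>, hence \<open>q^(m * n)\<close>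
  to the substituted factor, and the law of addition absorbs the resulting block
  \<open>q^(m * n) * [m]\<close>. The substitution enters through its additivity.

  Thus \<open>n \<mapsto> [n]\<close> is a bijection from the integers onto the quantum integers that carries the sum
  and the product to the quantum operations, and the ring axioms are transported along it.\<close>

lemma qpow_eq_iff: "qpow m = qpow n \<longleftrightarrow> m = n"
proof
  assume "qpow m = qpow n"
  then have "Poly_Mapping.lookup (qpow m) m = Poly_Mapping.lookup (qpow n) m"
    by simp
  then show "m = n"
    by (simp add: qpow_def lookup_single when_def split: if_splits)
qed simp

lemma one_minus_q_nonzero: "1 - qpow 1 \<noteq> 0"
  using qpow_eq_iff[of 0 1] by (simp add: qpow_0)

lemma quantum_int_eq_iff: "quantum_int m = quantum_int n \<longleftrightarrow> m = n"
proof
  assume "quantum_int m = quantum_int n"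
  then have "1 - qpow m = 1 - qpow n"
    by (metis quantum_int_quotient)
  then show "m = n"
    by (simp add: qpow_eq_iff)
qed simp

lemma quantum_index_quantum_int: "quantum_index (quantum_int m) = m"
  by (simp add: quantum_index_def quantum_int_eq_iff)

lemma quantum_int_add: "quantum_int (m + n) = quantum_int m + qpow m * quantum_int n"
proof -
  have "(1 - qpow 1) * (quantum_int m + qpow m * quantum_int n)
      = (1 - qpow 1) * quantum_int m + qpow m * ((1 - qpow 1) * quantum_int n)"
    by (simp only: distrib_left mult.left_commute)
  also have "\<dots> = 1 - qpow (m + n)"
    by (simp only: quantum_int_quotient) (simp add: qpow_add right_diff_distrib)
  also have "\<dots> = (1 - qpow 1) * quantum_int (m + n)"
    by (simp only: quantum_int_quotient)
  finally show ?thesis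
    using one_minus_q_nonzero by simp
qed

lemma quantum_int_0: "quantum_int 0 = 0"
  by (simp add: quantum_int_def)

lemma quantum_int_1: "quantum_int 1 = 1"
proof -
  have "{0..<1::int} = {0}" by auto
  then show ?thesis
    by (simp add: quantum_int_def qpow_0)
qed

text \<open>The sum that defines the substitution ranges over the support. A sum over any larger finite
  set has the same value, so two Laurent polynomials can be compared over a common index set.\<close>

lemma subst_qpow_superset:
  assumes "finite A" "Poly_Mapping.keys f \<subseteq> A"
  shows "subst_qpow m f = (\<Sum>k\<in>A. Poly_Mapping.single (m * k) (Poly_Mapping.lookup f k))"
  unfolding subst_qpow_def
  by (rule sum.mono_neutral_left) (use assms in \<open>auto simp: in_keys_iff\<close>)

lemma subst_qpow_add: "subst_qpow m (f + g) = subst_qpow m f + subst_qpow m g"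
proof -
  let ?A = "Poly_Mapping.keys f \<union> Poly_Mapping.keys g"
  have "Poly_Mapping.keys (f + g) \<subseteq> ?A"
    by (rule Poly_Mapping.keys_add)
  then show ?thesis
    by (simp add: subst_qpow_superset[of ?A] lookup_add single_add sum.distrib)
qed

lemma subst_qpow_0: "subst_qpow m 0 = 0"
  by (simp add: subst_qpow_def)

lemma subst_qpow_qpow: "subst_qpow m (qpow n) = qpow (m * n)"
  by (simp add: subst_qpow_def qpow_def)

lemma quantum_int_mult: "quantum_int (m * n) = quantum_int m * subst_qpow m (quantum_int n)"
proof -
  have step: "quantum_int m * subst_qpow m (quantum_int (i + 1))
      = quantum_int m * subst_qpow m (quantum_int i) + qpow (m * i) * quantum_int m" for i
    by (simp add: quantum_int_add quantum_int_1 subst_qpow_add subst_qpow_qpow distrib_left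
        mult.commute)
  have index_step: "quantum_int (m * (i + 1)) = quantum_int (m * i) + qpow (m * i) * quantum_int m"
    for i
    by (simp add: quantum_int_add distrib_left)
  show ?thesis
  proof (induction n rule: int_induct[where k = 0])
    case base
    show ?case by (simp add: quantum_int_0 subst_qpow_0)
  next
    case (step1 i)
    then show ?case by (simp only: step index_step)
  next
    case (step2 i)
    then show ?case using step[of "i - 1"] index_step[of "i - 1"] by simp
  qed
qed

lemma qadd_quantum_int: "qadd (quantum_int m) (quantum_int n) = quantum_int (m + n)"
  by (simp add: qadd_def quantum_index_quantum_int quantum_int_add)

lemma qmult_quantum_int: "qmult (quantum_int m) (quantum_int n) = quantum_int (m * n)"
  by (simp add: qmult_def quantum_index_quantum_int quantum_int_mult)

lemma quantum_int_ring_iso: "quantum_int \<in> ring_iso int_ring quantum_ring"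
proof (rule ring_iso_memI)
  show "bij_betw quantum_int (carrier int_ring) (carrier quantum_ring)"
    by (simp add: quantum_ring_def bij_betw_def inj_on_def quantum_int_eq_iff)
qed (simp_all add: quantum_ring_def qadd_quantum_int qmult_quantum_int)

lemma cring_quantum_ring: "cring quantum_ring"
proof -
  have "cring (quantum_ring \<lparr>zero := quantum_int \<zero>\<^bsub>int_ring\<^esub>\<rparr>)"
    by (rule cring.ring_iso_imp_img_cring[OF int_is_cring quantum_int_ring_iso])
  then show ?thesis
    by (simp add: quantum_ring_def)
qed

theorem mainTheorem2:
  shows "(\<forall>m n. qadd (quantum_int m) (quantum_int n) = quantum_int m + qpow m * quantum_int n)
    \<and> (\<forall>m n. qmult (quantum_int m) (quantum_int n) = quantum_int m * subst_qpow m (quantum_int n))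
    \<and> cring quantum_ring
    \<and> quantum_int \<in> ring_iso int_ring quantum_ring"
  by (simp add: qadd_quantum_int quantum_int_add qmult_quantum_int quantum_int_mult
      cring_quantum_ring quantum_int_ring_iso)

end
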